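(* Let $\mu > 0$, let $D \subset \mathbb{R}^3$ be a bounded domain whose complement is connected, and let $r > 0$ be such that $|B_r| = |D|$. Suppose that for some $x_0 \in D$ both identities \[ a_3(\mu r)\, E_\mu^{+}(x,x_0) = \frac{1}{|D|}\int_D E_\mu^{+}(y,x)\,dy, \qquad a_3(\mu r)\, E_\mu^{-}(x,x_0) = \frac{1}{|D|}\int_D E_\mu^{-}(y,x)\,dy \] hold for every $x \in \mathbb{R}^3\setminus D$. Then $D = B_r(x_0)$.
   Context: A domain is a connected open set; $|D|$ is the volume (Lebesgue measure) of $D$; $B_r(x_0)$ is the open ball of radius $r$ centred at $x_0$ and $|B_r|$ is its volume. For $x \neq y$ in $\mathbb{R}^3$, \[ E_\mu^{\pm}(x,y) = \frac{\exp\{\pm\mu|x-y|\}}{|x-y|}. \] The function $a_3$ is defined for $t>0$ by $a_3(t) = \Gamma(5/2)\, I_{3/2}(t)/(t/2)^{3/2}$, where $I_{3/2}$ is the modified Bessel function of the first kind of order $3/2$; equivalently $a_3(t) = 3\,(t\cosh t - \sinh t)/t^3$. *)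

theory Defs
  imports "HOL-Analysis.Analysis"
begin

text \<open>Modified Bessel function of the first kind of real order \<open>\<nu>\<close>, for a real argument
  \<open>t > 0\<close>, given by its standard power series.\<close>

definition bessel_I :: "real \<Rightarrow> real \<Rightarrow> real" where
  "bessel_I \<nu> t = (\<Sum>k. (t / 2) powr (2 * real k + \<nu>) / (fact k * Gamma (real k + \<nu> + 1)))"

definition a3 :: "real \<Rightarrow> real" where
  "a3 t = Gamma (5/2) * bessel_I (3/2) t / (t / 2) powr (3/2)"

definition E_plus :: "real \<Rightarrow> real^3 \<Rightarrow> real^3 \<Rightarrow> real" where
  "E_plus \<mu> x y = exp (\<mu> * norm (x - y)) / norm (x - y)"

definition E_minus :: "real \<Rightarrow> real^3 \<Rightarrow> real^3 \<Rightarrow> real" where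
  "E_minus \<mu> x y = exp (- \<mu> * norm (x - y)) / norm (x - y)"

lemma a3_series_coeff:
  "pochhammer (5/2 :: real) k * fact k * 4 ^ k * (3 * (2 * real k + 2)) = fact (2 * k + 3)"
proof (induction k)
  case 0
  then show ?case by (simp add: fact_numeral)
next
  case (Suc k)
  have "fact (2 * Suc k + 3) = (2 * real k + 5) * (2 * real k + 4) * fact (2 * k + 3)"
  proof -
    have "2 * Suc k + 3 = Suc (Suc (2 * k + 3))" by simp
    then show ?thesis by (simp only: fact_Suc) (simp add: algebra_simps)
  qed
  then show ?case
    unfolding Suc.IH[symmetric] by (simp add: pochhammer_Suc field_simps)
qed

lemma a3_closed_form:
  assumes t: "t > 0"
  shows "a3 t = 3 * (t * cosh t - sinh t) / t ^ 3"
proof -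
  have G0: "Gamma (5/2 :: real) \<noteq> 0"
    using Gamma_real_pos[of "5/2"] by (metis less_irrefl zero_less_divide_iff zero_less_numeral)
  have c: "(\<lambda>n. t ^ (2 * n) / fact (2 * n)) sums cosh t"
  proof -
    have "(\<lambda>n. (if even n then t ^ n /\<^sub>R fact n else 0)) sums cosh t"
      by (rule cosh_converges)
    then have "(\<lambda>n. if even (2 * n) then t ^ (2 * n) /\<^sub>R fact (2 * n) else 0) sums cosh t"
      by (subst sums_mono_reindex[of "\<lambda>n. 2 * n"]) (auto simp: strict_mono_def elim!: evenE)
    then show ?thesis by (simp add: divide_inverse mult.commute)
  qed
  have s: "(\<lambda>n. t ^ (2 * n + 1) / fact (2 * n + 1)) sums sinh t"
  proof -
    have "(\<lambda>n. (if even n then 0 else t ^ n /\<^sub>R fact n)) sums sinh t"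
      by (rule sinh_converges)
    then have "(\<lambda>n. if even (2 * n + 1) then 0 else t ^ (2 * n + 1) /\<^sub>R fact (2 * n + 1)) sums sinh t"
      by (subst sums_mono_reindex[of "\<lambda>n. 2 * n + 1"]) (auto simp: strict_mono_def elim!: oddE)
    then show ?thesis by (simp add: divide_inverse mult.commute)
  qed
  have "(\<lambda>n. t * (t ^ (2 * n) / fact (2 * n)) - t ^ (2 * n + 1) / fact (2 * n + 1))
          sums (t * cosh t - sinh t)"
    by (intro sums_diff sums_mult c s)
  then have "(\<lambda>n. t * (t ^ (2 * Suc n) / fact (2 * Suc n)) - t ^ (2 * Suc n + 1) / fact (2 * Suc n + 1))
          sums (t * cosh t - sinh t)"
    by (subst sums_Suc_iff) simp
  then have 1: "(\<lambda>n. 3 / t ^ 3 * (t * (t ^ (2 * Suc n) / fact (2 * Suc n)) - t ^ (2 * Suc n + 1) / fact (2 * Suc n + 1)))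
          sums (3 / t ^ 3 * (t * cosh t - sinh t))"
    by (rule sums_mult)
  have term_eq: "3 / t ^ 3 * (t * (t ^ (2 * Suc n) / fact (2 * Suc n)) - t ^ (2 * Suc n + 1) / fact (2 * Suc n + 1))
      = Gamma (5/2) / (t / 2) powr (3/2) *
          ((t / 2) powr (2 * real n + 3/2) / (fact n * Gamma (real n + 3/2 + 1)))" for n
  proof -
    have f: "(fact (2 * n + 3) :: real) = (2 * real n + 3) * fact (2 * n + 2)"
    proof -
      have "2 * n + 3 = Suc (2 * n + 2)" by simp
      then show ?thesis by (simp only: fact_Suc) simp
    qed
    have e: "2 * Suc n = 2 * n + 2" "2 * n + 2 + 1 = 2 * n + 3" by simp_all
    have L: "3 / t ^ 3 * (t * (t ^ (2 * Suc n) / fact (2 * Suc n)) - t ^ (2 * Suc n + 1) / fact (2 * Suc n + 1))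
       = t ^ (2 * n) * (3 * (2 * real n + 2)) / fact (2 * n + 3)"
    proof -
      have aux: "3 / t ^ 3 * (t * (T * t ^ 2 / F) - T * t ^ 3 / ((2 * a + 3) * F))
          = T * (3 * (2 * a + 2)) / ((2 * a + 3) * F)"
        if "F > 0" "a \<ge> 0" for T F a :: real
      proof -
        have "2 * a + 3 \<noteq> 0" "F \<noteq> 0" using that by auto
        then show ?thesis
          using t by (simp add: divide_simps) (simp add: algebra_simps power2_eq_square power3_eq_cube)
      qed
      show ?thesis
        unfolding e f power_add[of t "2 * n" 2] power_add[of t "2 * n" 3]
        by (rule aux) auto
    qed
    have G: "Gamma (real n + 3/2 + 1) = pochhammer (5/2) n * Gamma (5/2 :: real)"
    proof -
      have "(5/2 :: real) \<notin> \<int>\<^sub>\<le>\<^sub>0" by (auto elim!: nonpos_Ints_cases simp: field_simps)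
      moreover note G0
      moreover have "real n + 3/2 + 1 = 5/2 + real n" by simp
      ultimately show ?thesis
        using pochhammer_Gamma[of "5/2 :: real" n] by (simp add: field_simps)
    qed
    have P: "(t / 2) powr (2 * real n + 3/2) = (t ^ (2 * n) / 4 ^ n) * (t / 2) powr (3/2)"
    proof -
      have "(t / 2) powr (2 * real n) = (t / 2) ^ (2 * n)"
        using t powr_realpow[of "t/2" "2 * n"] by simp
      then show ?thesis by (simp add: powr_add power_mult power_divide)
    qed
    have nz: "Gamma (5/2 :: real) \<noteq> 0" "(t / 2) powr (3/2) \<noteq> 0" "pochhammer (5/2 :: real) n > 0"
      using t G0 by (auto intro: pochhammer_pos)
    have R: "Gamma (5/2) / (t / 2) powr (3/2) *
          ((t / 2) powr (2 * real n + 3/2) / (fact n * Gamma (real n + 3/2 + 1)))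
        = t ^ (2 * n) / (pochhammer (5/2) n * fact n * 4 ^ n)"
      unfolding G P using nz by (simp add: field_simps)
    show ?thesis
      unfolding L R a3_series_coeff[symmetric] using nz by (simp add: divide_simps)
  qed
  let ?b = "\<lambda>k. (t / 2) powr (2 * real k + 3/2) / (fact k * Gamma (real k + 3/2 + 1))"
  have nz: "Gamma (5/2) / (t / 2) powr (3/2) \<noteq> (0::real)"
    using t G0 by auto
  have 2: "(\<lambda>n. Gamma (5/2) / (t / 2) powr (3/2) * ?b n) sums (3 / t ^ 3 * (t * cosh t - sinh t))"
    using 1 unfolding term_eq .
  then have "summable ?b"
    using nz summable_mult_D[of "Gamma (5/2) / (t / 2) powr (3/2)" ?b] sums_summable by blast
  then have "(\<lambda>n. Gamma (5/2) / (t / 2) powr (3/2) * ?b n)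
      sums (Gamma (5/2) / (t / 2) powr (3/2) * bessel_I (3/2) t)"
    unfolding bessel_I_def by (intro sums_mult summable_sums)
  with 2 have "Gamma (5/2) / (t / 2) powr (3/2) * bessel_I (3/2) t = 3 / t ^ 3 * (t * cosh t - sinh t)"
    using sums_unique2 by blast
  then show ?thesis by (simp add: a3_def)
qed

end

theory Submission
  imports Defs
begin

text \<open>Half the difference of the two identities is an identity with the kernel \<open>w t = sinh (\<mu> t) / t\<close>. Unlike
  \<open>E_plus\<close> and \<open>E_minus\<close>, this kernel has no singularity at \<open>0\<close>, and \<open>w |y - x|\<close> has the mean value
  property for \<open>\<Delta> u = \<mu>\<^sup>2 u\<close> on all balls. Averaging the identity over a spherical shell about \<open>x\<^sub>0\<close> that
  lies outside \<open>D\<close> therefore transports it to the centre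
  (\<open>nn_integral_sinh_kernel_center\<close>), and the factor \<open>a3 (\<mu> r)\<close> is exactly the one that makes the result read
  \<open>\<integral>\<^sub>D w |y - x\<^sub>0| dy = \<integral>\<^sub>B w |y - x\<^sub>0| dy\<close> with \<open>B\<close> the ball of radius \<open>r\<close> about \<open>x\<^sub>0\<close>.

  Now \<open>w\<close> is strictly increasing and \<open>|D| = |B|\<close>, so mass of \<open>D\<close> outside \<open>B\<close> would make the left integral
  strictly larger. Hence \<open>D\<close> and \<open>B\<close> agree up to a null set
  (\<open>AE_eq_cball_of_radial_integral_eq\<close>), and as \<open>D\<close> is open, \<open>D \<subseteq> B\<close>.

  It remains to exclude that \<open>D\<close> misses a null set of points of \<open>B\<close>. At such a point \<open>x\<close> the identity with
  \<open>E_minus\<close> holds by assumption, and its integral over \<open>D\<close> equals the one over \<open>B\<close>. But inside the ball, away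
  from the centre, the potential of the ball is strictly smaller than the formula valid outside
  (\<open>nn_integral_cball_E_minus_less\<close>), and \<open>x \<noteq> x\<^sub>0\<close> because \<open>x\<^sub>0 \<in> D\<close>.

  The explicit values all come from one formula for the integral of \<open>k |y - a| / |y - a|\<close> over a ball containing
  \<open>a\<close> (\<open>nn_integral_cball_radial_kernel\<close>). It is obtained by cutting the ball into discs perpendicular to the line
  through \<open>a\<close> and the centre: on each disc, and then across the discs, the integral is elementary.\<close>

section \<open>Lebesgue integrals over a ball, cut into discs\<close>

text \<open>Area of the annulus \<open>x < |w|\<^sup>2 \<le> \<rho>\<close> is \<open>\<pi> (\<rho> - x)\<close>, linear in \<open>x\<close>: in the variable
  \<open>u = |w|\<^sup>2\<close> planar Lebesgue measure has constant density \<open>\<pi>\<close>. Cutting off at \<open>\<rho>\<close> makes both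
  measures finite, so that they are determined by their values on half-lines.\<close>

lemma distr_norm_power2_disc:
  fixes \<rho> :: real
  assumes "\<rho> \<ge> 0"
  shows "distr (density lborel (indicator {w::complex. (norm w)\<^sup>2 \<le> \<rho>})) borel (\<lambda>w. (norm w)\<^sup>2)
       = density lborel (\<lambda>u. ennreal pi * indicator {0..\<rho>} u)" (is "?M = ?N")
proof (rule measure_eqI_lessThan)
  have disc: "{w::complex. (norm w)\<^sup>2 \<le> u} = cball 0 (sqrt u)" if "u \<ge> 0" for u
    proof -
    have "(norm w)\<^sup>2 \<le> u \<longleftrightarrow> norm w \<le> sqrt u" for w :: complex
      using real_sqrt_le_iff[of "(norm w)\<^sup>2" u] by (simp only: real_sqrt_abs abs_norm_cancel)
    then show ?thesis by (simp add: cball_def dist_norm)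
  qed
  have M: "emeasure ?M {x<..} = emeasure lborel ({w::complex. (norm w)\<^sup>2 \<le> \<rho>} \<inter> {w. x < (norm w)\<^sup>2})" for x
  proof -
    have "emeasure ?M {x<..} = emeasure (density lborel (indicator {w::complex. (norm w)\<^sup>2 \<le> \<rho>})) {w. x < (norm w)\<^sup>2}"
      by (subst emeasure_distr) (auto simp: vimage_def)
    also have "\<dots> = (\<integral>\<^sup>+ w. indicator ({w::complex. (norm w)\<^sup>2 \<le> \<rho>} \<inter> {w. x < (norm w)\<^sup>2}) w \<partial>lborel)"
      by (subst emeasure_density) (auto intro!: nn_integral_cong simp: indicator_def simp del: nn_integral_indicator)
    finally show ?thesis by simp
  qed
  have N: "emeasure ?N {x<..} = ennreal pi * emeasure lborel ({0..\<rho>} \<inter> {x<..})" for x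
  proof -
    have "emeasure ?N {x<..} = (\<integral>\<^sup>+ u. ennreal pi * indicator ({0..\<rho>} \<inter> {x<..}) u \<partial>lborel)"
      by (subst emeasure_density) (auto intro!: nn_integral_cong simp: indicator_def)
    then show ?thesis by (simp add: nn_integral_cmult_indicator)
  qed
  have vol: "emeasure lborel {w::complex. (norm w)\<^sup>2 \<le> u} = ennreal (pi * u)" if "u \<ge> 0" for u
    using that by (simp add: disc emeasure_cball unit_ball_vol_2)
  show "emeasure ?M {x<..} < \<infinity>" for x
  proof -
    have "emeasure ?M {x<..} \<le> emeasure lborel {w::complex. (norm w)\<^sup>2 \<le> \<rho>}"
      unfolding M by (intro emeasure_mono) auto
    also have "\<dots> < \<infinity>" unfolding vol[OF assms] by simp
    finally show ?thesis .
  qed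
  show "emeasure ?M {x<..} = emeasure ?N {x<..}" for x
  proof -
    consider "x < 0" | "0 \<le> x" "x \<le> \<rho>" | "x > \<rho>" by linarith
    then show ?thesis
    proof cases
      case 1
      then have "{w::complex. (norm w)\<^sup>2 \<le> \<rho>} \<inter> {w. x < (norm w)\<^sup>2} = {w. (norm w)\<^sup>2 \<le> \<rho>}"
        by (auto intro: less_le_trans[of x 0])
      moreover have "{0..\<rho>} \<inter> {x<..} = {0..\<rho>}" using 1 by auto
      ultimately show ?thesis
        unfolding M N using vol[OF assms] assms by (simp add: ennreal_mult)
    next
      case 2
      have "{w::complex. (norm w)\<^sup>2 \<le> \<rho>} \<inter> {w. x < (norm w)\<^sup>2} = {w. (norm w)\<^sup>2 \<le> \<rho>} - {w. (norm w)\<^sup>2 \<le> x}"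
        by auto
      also have "emeasure lborel \<dots>
          = emeasure lborel {w::complex. (norm w)\<^sup>2 \<le> \<rho>} - emeasure lborel {w::complex. (norm w)\<^sup>2 \<le> x}"
      proof (rule emeasure_Diff)
        show "emeasure lborel {w::complex. (norm w)\<^sup>2 \<le> x} \<noteq> \<infinity>" using vol 2 by simp
        show "{w::complex. (norm w)\<^sup>2 \<le> x} \<subseteq> {w. (norm w)\<^sup>2 \<le> \<rho>}" using 2 by auto
      qed auto
      also have "\<dots> = ennreal pi * ennreal (\<rho> - x)"
        using 2 assms by (simp add: vol ennreal_minus ennreal_mult[symmetric] algebra_simps)
      finally have *: "emeasure lborel ({w::complex. (norm w)\<^sup>2 \<le> \<rho>} \<inter> {w. x < (norm w)\<^sup>2}) = ennreal pi * ennreal (\<rho> - x)" .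
      have "{0..\<rho>} \<inter> {x<..} = {x<..\<rho>}" using 2 by auto
      then show ?thesis unfolding M N * using 2 by simp
    next
      case 3
      then have "{w::complex. (norm w)\<^sup>2 \<le> \<rho>} \<inter> {w. x < (norm w)\<^sup>2} = {}" "{0..\<rho>} \<inter> {x<..} = {}"
        by auto
      then show ?thesis unfolding M N by simp
    qed
  qed
qed auto

lemma nn_integral_disc_radial:
  fixes h :: "real \<Rightarrow> ennreal"
  assumes [measurable]: "h \<in> borel_measurable borel" and "\<rho> \<ge> 0"
  shows "(\<integral>\<^sup>+ w. h ((norm w)\<^sup>2) * indicator {w. (norm w)\<^sup>2 \<le> \<rho>} w \<partial>(lborel :: complex measure))
       = ennreal pi * (\<integral>\<^sup>+ u. h u * indicator {0..\<rho>} u \<partial>lborel)"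
proof -
  have "(\<integral>\<^sup>+ w. h ((norm w)\<^sup>2) * indicator {w. (norm w)\<^sup>2 \<le> \<rho>} w \<partial>(lborel :: complex measure))
      = (\<integral>\<^sup>+ u. h u \<partial>distr (density lborel (indicator {w::complex. (norm w)\<^sup>2 \<le> \<rho>})) borel (\<lambda>w. (norm w)\<^sup>2))"
    by (subst nn_integral_distr) (auto simp: nn_integral_density mult.commute)
  also have "\<dots> = ennreal pi * (\<integral>\<^sup>+ u. h u * indicator {0..\<rho>} u \<partial>lborel)"
    unfolding distr_norm_power2_disc[OF \<open>\<rho> \<ge> 0\<close>]
    by (subst nn_integral_density) (auto simp: nn_integral_cmult[symmetric] mult_ac)
  finally show ?thesis .
qed

definition vec_of_axis_plane :: "real \<times> complex \<Rightarrow> real^3" where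
  "vec_of_axis_plane p = fst p *\<^sub>R axis 1 1 + Re (snd p) *\<^sub>R axis 2 1 + Im (snd p) *\<^sub>R axis 3 1"

lemma vec_of_axis_plane_nth [simp]: "vec_of_axis_plane p $ 1 = fst p" "vec_of_axis_plane p $ 2 = Re (snd p)" "vec_of_axis_plane p $ 3 = Im (snd p)"
  by (simp_all add: vec_of_axis_plane_def axis_def)

lemma measurable_vec_of_axis_plane [measurable]: "vec_of_axis_plane \<in> borel_measurable borel"
  unfolding vec_of_axis_plane_def
  by (intro borel_measurable_continuous_onI continuous_intros)

lemma distr_vec_of_axis_plane: "distr lborel borel vec_of_axis_plane = lborel"
proof (rule lborel_eqI[symmetric])
  fix l u :: "real^3"
  assume le': "\<And>b. b \<in> Basis \<Longrightarrow> l \<bullet> b \<le> u \<bullet> b"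
  have le: "l $ i \<le> u $ i" for i
    using le'[of "axis i 1"] by (simp add: inner_axis axis_in_Basis_iff)
  have "vec_of_axis_plane -` box l u = box (l $ 1, Complex (l $ 2) (l $ 3)) (u $ 1, Complex (u $ 2) (u $ 3))"
    by (auto simp: mem_box_cart forall_3 mem_box Basis_prod_def Basis_complex_def)
  then have "emeasure (distr lborel borel vec_of_axis_plane) (box l u)
      = emeasure lborel (box (l $ 1, Complex (l $ 2) (l $ 3)) (u $ 1, Complex (u $ 2) (u $ 3)))"
    by (subst emeasure_distr) auto
  also have "\<dots> = ennreal ((u - l) $ 1 * (u - l) $ 2 * (u - l) $ 3)"
    using le
    by (subst emeasure_lborel_box) 
      (auto simp: Basis_prod_def Basis_complex_def prod.union_disjoint prod.reindex inj_on_def)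
  also have "\<dots> = ennreal (\<Prod>b\<in>Basis. (u - l) \<bullet> b)"
  proof -
    have "(\<Prod>b\<in>Basis. (u - l) \<bullet> b) = (\<Prod>i\<in>UNIV. (u - l) $ i)"
      by (simp add: Basis_vec_def UNION_singleton_eq_range prod.reindex axis_eq_axis inj_on_def inner_axis)
    also have "\<dots> = (u - l) $ 1 * (u - l) $ 2 * (u - l) $ 3"
      unfolding UNIV_3 by simp
    finally show ?thesis by simp
  qed
  finally show "emeasure (distr lborel borel vec_of_axis_plane) (box l u) = ennreal (\<Prod>b\<in>Basis. (u - l) \<bullet> b)" .
qed simp

lemma nn_integral_cylindrical:
  fixes f :: "real^3 \<Rightarrow> ennreal"
  assumes [measurable]: "f \<in> borel_measurable borel"
  shows "(\<integral>\<^sup>+ y. f y \<partial>lborel) = (\<integral>\<^sup>+ z. \<integral>\<^sup>+ w. f (vec_of_axis_plane (z, w)) \<partial>lborel \<partial>lborel)"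
proof -
  have "(\<integral>\<^sup>+ y. f y \<partial>lborel) = (\<integral>\<^sup>+ p. f (vec_of_axis_plane p) \<partial>lborel)"
    by (subst distr_vec_of_axis_plane[symmetric], subst nn_integral_distr) auto
  also have "\<dots> = (\<integral>\<^sup>+ p. f (vec_of_axis_plane p) \<partial>(lborel \<Otimes>\<^sub>M lborel))"
    by (simp add: lborel_prod)
  also have "\<dots> = (\<integral>\<^sup>+ z. \<integral>\<^sup>+ w. f (vec_of_axis_plane (z, w)) \<partial>lborel \<partial>lborel)"
    by (intro lborel.nn_integral_fst[symmetric]) (simp add: lborel_prod)
  finally show ?thesis .
qed

text \<open>The volume of orthogonal images is known for measurable sets; in this form, as the invariance of a
  Borel measure, it can be used inside an integral.\<close>

lemma distr_lborel_orthogonal: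
  fixes T :: "real^'n::{finite,wellorder} \<Rightarrow> real^'n::_"
  assumes T: "orthogonal_transformation T"
  shows "distr lborel borel T = lborel"
proof (rule lborel_eqI[symmetric])
  have lin: "linear T" using T by (rule orthogonal_transformation_linear)
  then have [measurable]: "T \<in> borel_measurable borel"
    by (intro borel_measurable_continuous_onI linear_continuous_on) (simp add: linear_linear)
  have bij: "bij T" using T by (rule orthogonal_transformation_bij)
  fix l u :: "real^'n::_"
  assume le: "\<And>b. b \<in> Basis \<Longrightarrow> l \<bullet> b \<le> u \<bullet> b"
  have T': "orthogonal_transformation (inv T)" using T by (rule orthogonal_transformation_inv)
  have "emeasure (distr lborel borel T) (box l u) = emeasure lborel (T -` box l u)"
    by (subst emeasure_distr) auto
  also have "\<dots> = emeasure lebesgue (inv T ` box l u)"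
    using measurable_sets_borel[of T borel "box l u"] by (simp flip: bij_vimage_eq_inv_image[OF bij])
  also have "\<dots> = ennreal (measure lebesgue (inv T ` box l u))"
    using measurable_orthogonal_image[OF T', of "box l u"] by (simp add: emeasure_eq_measure2)
  also have "\<dots> = ennreal (measure lebesgue (box l u))"
    by (subst measure_orthogonal_image[OF T']) auto
  also have "\<dots> = ennreal (\<Prod>b\<in>Basis. (u - l) \<bullet> b)"
    using le by (simp add: measure_lborel_box_eq)
  finally show "emeasure (distr lborel borel T) (box l u) = ennreal (\<Prod>b\<in>Basis. (u - l) \<bullet> b)" .
qed simp

text \<open>An integrand that depends only on the distance to \<open>a\<close> sees the ball about \<open>c\<close> only through \<open>dist a c\<close>,
  so \<open>c\<close> may be moved to the origin and \<open>a\<close> to the first coordinate axis.\<close>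

lemma nn_integral_cball_rotate:
  fixes a c :: "real^3" and g :: "real \<Rightarrow> ennreal"
  assumes [measurable]: "g \<in> borel_measurable borel"
  shows "(\<integral>\<^sup>+ y. g (dist y a) * indicator (cball c R) y \<partial>lborel)
       = (\<integral>\<^sup>+ y. g (norm (y - dist a c *\<^sub>R axis 1 1 :: real^3)) * indicator (cball 0 R) y \<partial>lborel)"
proof -
  have "norm (dist a c *\<^sub>R axis 1 1 :: real^3) = norm (a - c)"
    unfolding norm_scaleR norm_axis_1 dist_norm by simp
  then obtain T :: "real^3 \<Rightarrow> real^3" where T: "orthogonal_transformation T" and Ta: "T (dist a c *\<^sub>R axis 1 1) = a - c"
    using orthogonal_transformation_exists by metis
  have lin: "linear T" using T by (rule orthogonal_transformation_linear)
  have [measurable]: "cball c R \<in> sets borel" by simp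
  from lin have [measurable]: "T \<in> borel_measurable borel"
    by (intro borel_measurable_continuous_onI linear_continuous_on) (simp add: linear_linear)
  have "distr lborel borel (\<lambda>y. c + T y) = distr (distr lborel borel T) borel ((+) c)"
    by (subst distr_distr) (simp_all add: comp_def)
  also have "\<dots> = lborel"
    by (simp only: distr_lborel_orthogonal[OF T] lborel_distr_plus)
  finally have eq: "distr lborel borel (\<lambda>y. c + T y) = lborel" .
  have "(\<integral>\<^sup>+ y. g (dist y a) * indicator (cball c R) y \<partial>lborel)
      = (\<integral>\<^sup>+ y. g (dist y a) * indicator (cball c R) y \<partial>distr lborel borel (\<lambda>y. c + T y))"
    by (simp only: eq)
  also have "\<dots> = (\<integral>\<^sup>+ y. g (dist (c + T y) a) * indicator (cball c R) (c + T y) \<partial>lborel)"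
    by (rule nn_integral_distr) measurable
  also have "\<dots> = (\<integral>\<^sup>+ y. g (norm (y - dist a c *\<^sub>R axis 1 1 :: real^3)) * indicator (cball 0 R) y \<partial>lborel)"
  proof (rule nn_integral_cong)
    fix y
    have "dist (c + T y) a = norm (T y - (a - c))" by (simp add: dist_norm algebra_simps)
    also have "\<dots> = norm (T (y - dist a c *\<^sub>R axis 1 1))"
      by (simp only: Ta[symmetric] linear_diff[OF lin])
    also have "\<dots> = norm (y - dist a c *\<^sub>R axis 1 1 :: real^3)"
      using T by (rule orthogonal_transformation_norm)
    finally have 1: "dist (c + T y) a = norm (y - dist a c *\<^sub>R axis 1 1 :: real^3)" .
    have "norm (T y) = norm y" using T by (rule orthogonal_transformation_norm)
    then have 2: "indicator (cball c R) (c + T y) = (indicator (cball 0 R) y :: ennreal)"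
      by (simp add: indicator_def dist_norm)
    show "g (dist (c + T y) a) * indicator (cball c R) (c + T y)
        = g (norm (y - dist a c *\<^sub>R axis 1 1)) * indicator (cball 0 R) y"
      unfolding 1 2 ..
  qed
  finally show ?thesis .
qed

lemma nn_integral_cball_slices:
  fixes g :: "real \<Rightarrow> ennreal"
  assumes [measurable]: "g \<in> borel_measurable borel" and "R \<ge> 0"
  shows "(\<integral>\<^sup>+ y. g (norm (y - s *\<^sub>R axis 1 1 :: real^3)) * indicator (cball 0 R) y \<partial>lborel)
       = (\<integral>\<^sup>+ z. ennreal pi * (\<integral>\<^sup>+ u. g (sqrt ((z - s)\<^sup>2 + u)) * indicator {0..R\<^sup>2 - z\<^sup>2} u \<partial>lborel)
             * indicator {-R..R} z \<partial>lborel)"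
proof -
  have [measurable]: "cball 0 R \<in> sets (borel :: (real^3) measure)" by simp
  have n1: "norm (vec_of_axis_plane (z, w) - s *\<^sub>R axis 1 1) = sqrt ((z - s)\<^sup>2 + (norm w)\<^sup>2)" for z w
    by (simp add: norm_vec_def L2_set_def sum_3 axis_def cmod_power2 add.assoc)
  have n0: "norm (vec_of_axis_plane (z, w)) \<le> R \<longleftrightarrow> \<bar>z\<bar> \<le> R \<and> (norm w)\<^sup>2 \<le> R\<^sup>2 - z\<^sup>2" for z w
  proof -
    have "norm (vec_of_axis_plane (z, w)) = sqrt (z\<^sup>2 + (norm w)\<^sup>2)"
      by (simp add: norm_vec_def L2_set_def sum_3 cmod_power2 add.assoc)
    then have "norm (vec_of_axis_plane (z, w)) \<le> R \<longleftrightarrow> z\<^sup>2 + (norm w)\<^sup>2 \<le> R\<^sup>2"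
      using \<open>R \<ge> 0\<close> real_sqrt_le_iff[of "z\<^sup>2 + (norm w)\<^sup>2" "R\<^sup>2"] by (simp only: real_sqrt_abs abs_of_nonneg)
    moreover have "\<bar>z\<bar> \<le> R" if "z\<^sup>2 + (norm w)\<^sup>2 \<le> R\<^sup>2"
    proof (rule power2_le_imp_le)
      show "\<bar>z\<bar>\<^sup>2 \<le> R\<^sup>2" using that zero_le_power2[of "norm w"] unfolding power2_abs by linarith
    qed fact
    ultimately show ?thesis by (auto simp: algebra_simps)
  qed
  have "(\<integral>\<^sup>+ y. g (norm (y - s *\<^sub>R axis 1 1 :: real^3)) * indicator (cball 0 R) y \<partial>lborel)
      = (\<integral>\<^sup>+ z. \<integral>\<^sup>+ w. g (norm (vec_of_axis_plane (z, w) - s *\<^sub>R axis 1 1)) * indicator (cball 0 R) (vec_of_axis_plane (z, w)) \<partial>lborel \<partial>lborel)"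
    by (rule nn_integral_cylindrical) measurable
  also have "\<dots> = (\<integral>\<^sup>+ z. ennreal pi * (\<integral>\<^sup>+ u. g (sqrt ((z - s)\<^sup>2 + u)) * indicator {0..R\<^sup>2 - z\<^sup>2} u \<partial>lborel)
             * indicator {-R..R} z \<partial>lborel)"
  proof (rule nn_integral_cong)
    fix z :: real
    show "(\<integral>\<^sup>+ w. g (norm (vec_of_axis_plane (z, w) - s *\<^sub>R axis 1 1)) * indicator (cball 0 R) (vec_of_axis_plane (z, w)) \<partial>lborel)
        = ennreal pi * (\<integral>\<^sup>+ u. g (sqrt ((z - s)\<^sup>2 + u)) * indicator {0..R\<^sup>2 - z\<^sup>2} u \<partial>lborel) * indicator {-R..R} z"
    proof (cases "\<bar>z\<bar> \<le> R")
      case True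
      then have "R\<^sup>2 - z\<^sup>2 \<ge> 0" using abs_le_square_iff[of z R] \<open>R \<ge> 0\<close> by simp
      have "(\<integral>\<^sup>+ w. g (norm (vec_of_axis_plane (z, w) - s *\<^sub>R axis 1 1)) * indicator (cball 0 R) (vec_of_axis_plane (z, w)) \<partial>lborel)
          = (\<integral>\<^sup>+ w. g (sqrt ((z - s)\<^sup>2 + (norm w)\<^sup>2)) * indicator {w::complex. (norm w)\<^sup>2 \<le> R\<^sup>2 - z\<^sup>2} w \<partial>lborel)"
        using True by (intro nn_integral_cong) (simp add: n1 n0 indicator_def)
      also have "\<dots> = ennreal pi * (\<integral>\<^sup>+ u. g (sqrt ((z - s)\<^sup>2 + u)) * indicator {0..R\<^sup>2 - z\<^sup>2} u \<partial>lborel)"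
        by (rule nn_integral_disc_radial) (measurable, fact)
      also have "\<dots> = \<dots> * indicator {-R..R} z" using True by (simp add: abs_le_iff)
      finally show ?thesis .
    next
      case False
      then have "z \<notin> {-R..R}" by auto
      with False show ?thesis by (simp add: n1 n0 indicator_def)
    qed
  qed
  finally show ?thesis .
qed

text \<open>On the disc at height \<open>d\<close> over the pole, the distance to the pole is \<open>t = sqrt (d\<^sup>2 + u)\<close> with
  \<open>u = |w|\<^sup>2\<close>, and \<open>du = 2 t dt\<close> cancels the denominator of the kernel \<open>k t / t\<close>. This is why
  kernels are written in this form throughout.\<close>

lemma nn_integral_radial_kernel_slice:
  fixes k G :: "real \<Rightarrow> real"
  assumes G: "\<And>t. (G has_real_derivative k t) (at t)" and k0: "\<And>t. t \<ge> 0 \<Longrightarrow> k t \<ge> 0" and "h \<ge> 0"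
  shows "(\<integral>\<^sup>+ u. ennreal (k (sqrt (d\<^sup>2 + u)) / sqrt (d\<^sup>2 + u)) * indicator {0..h} u \<partial>lborel)
       = ennreal (2 * (G (sqrt (d\<^sup>2 + h)) - G \<bar>d\<bar>))"
proof (rule nn_integral_has_integral_lebesgue')
  have cont: "continuous_on UNIV G"
    using G by (meson DERIV_isCont continuous_at_imp_continuous_on)
  have "((\<lambda>u. k (sqrt (d\<^sup>2 + u)) / sqrt (d\<^sup>2 + u)) has_integral
         2 * G (sqrt (d\<^sup>2 + h)) - 2 * G (sqrt (d\<^sup>2 + 0))) {0..h}"
  proof (rule fundamental_theorem_of_calculus_strong[of "{0}"])
    fix u assume u: "u \<in> {0..h} - {0::real}"
    then have pos: "d\<^sup>2 + u > 0" by (auto intro: add_nonneg_pos)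
    have "((\<lambda>u. 2 * G (sqrt (d\<^sup>2 + u))) has_real_derivative
           2 * (k (sqrt (d\<^sup>2 + u)) * (inverse (sqrt (d\<^sup>2 + u)) / 2))) (at u)"
      using pos by (auto intro!: derivative_eq_intros DERIV_chain2[OF G])
    then show "((\<lambda>u. 2 * G (sqrt (d\<^sup>2 + u))) has_vector_derivative k (sqrt (d\<^sup>2 + u)) / sqrt (d\<^sup>2 + u)) (at u)"
      by (simp add: has_real_derivative_iff_has_vector_derivative field_simps)
  next
    show "continuous_on {0..h} (\<lambda>u. 2 * G (sqrt (d\<^sup>2 + u)))"
      by (intro continuous_intros continuous_on_compose2[OF cont]) auto
  qed (use \<open>h \<ge> 0\<close> in auto)
  then show "((\<lambda>u. k (sqrt (d\<^sup>2 + u)) / sqrt (d\<^sup>2 + u)) has_integral 2 * (G (sqrt (d\<^sup>2 + h)) - G \<bar>d\<bar>)) {0..h}"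
    by (simp add: algebra_simps)
qed (use k0 in auto)

text \<open>The two following integrals are the contributions of the inner endpoint (the point of the slice on the
  axis) and of the outer endpoint (the rim of the slice, which lies on the sphere) to the integral over
  all slices.\<close>

lemma has_integral_primitive_abs:
  fixes G L :: "real \<Rightarrow> real"
  assumes L: "\<And>t. (L has_real_derivative G t) (at t)" and "\<bar>s\<bar> \<le> R"
  shows "((\<lambda>z. G \<bar>z - s\<bar>) has_integral L (R - s) + L (R + s) - 2 * L 0) {-R..R}"
proof -
  have cont: "continuous_on A L" for A
    using L by (meson DERIV_isCont continuous_at_imp_continuous_on)
  have 1: "((\<lambda>z. G \<bar>z - s\<bar>) has_integral - L (s - s) - (- L (s - -R))) {-R..s}"
  proof (rule fundamental_theorem_of_calculus)
    fix z assume "z \<in> {-R..s}"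
    have "((\<lambda>z. - L (s - z)) has_real_derivative - (G (s - z) * (0 - 1))) (at z within {-R..s})"
      by (rule derivative_eq_intros DERIV_chain2[OF L] refl | simp)+
    moreover have "\<bar>z - s\<bar> = s - z" using \<open>z \<in> _\<close> by simp
    ultimately show "((\<lambda>z. - L (s - z)) has_vector_derivative G \<bar>z - s\<bar>) (at z within {-R..s})"
      by (simp add: has_real_derivative_iff_has_vector_derivative)
  qed (use \<open>\<bar>s\<bar> \<le> R\<close> in auto)
  have 2: "((\<lambda>z. G \<bar>z - s\<bar>) has_integral L (R - s) - L (s - s)) {s..R}"
  proof (rule fundamental_theorem_of_calculus)
    fix z assume "z \<in> {s..R}"
    have "((\<lambda>z. L (z - s)) has_real_derivative (G (z - s) * (1 - 0))) (at z within {s..R})"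
      by (rule derivative_eq_intros DERIV_chain2[OF L] refl | simp)+
    then show "((\<lambda>z. L (z - s)) has_vector_derivative G \<bar>z - s\<bar>) (at z within {s..R})"
      using \<open>z \<in> _\<close> by (simp add: has_real_derivative_iff_has_vector_derivative)
  qed (use \<open>\<bar>s\<bar> \<le> R\<close> in auto)
  show ?thesis
    using has_integral_combine[OF _ _ 1 2] \<open>\<bar>s\<bar> \<le> R\<close> by (simp add: algebra_simps)
qed

lemma has_integral_primitive_chord:
  fixes G L N :: "real \<Rightarrow> real"
  assumes L: "\<And>t. (L has_real_derivative G t) (at t)" and N: "\<And>t. (N has_real_derivative L t) (at t)"
    and s: "0 < s" "s < R"
  shows "((\<lambda>z. G (sqrt (R\<^sup>2 + s\<^sup>2 - 2 * z * s))) has_integral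
          ((R + s) * L (R + s) - (R - s) * L (R - s) - N (R + s) + N (R - s)) / s) {-R..R}"
proof -
  let ?v = "\<lambda>z. sqrt (R\<^sup>2 + s\<^sup>2 - 2 * z * s)"
  let ?M = "\<lambda>z. - ((?v z * L (?v z) - N (?v z)) / s)"
  have "((\<lambda>z. G (?v z)) has_integral ?M R - ?M (-R)) {-R..R}"
  proof (rule fundamental_theorem_of_calculus)
    fix z assume z: "z \<in> {-R..R}"
    have "R\<^sup>2 + s\<^sup>2 - 2 * z * s = (R - s)\<^sup>2 + 2 * (R - z) * s" by (simp add: power2_eq_square algebra_simps)
    moreover have "(R - s)\<^sup>2 > 0" "2 * (R - z) * s \<ge> 0" using s z by auto
    ultimately have pos: "R\<^sup>2 + s\<^sup>2 - 2 * z * s > 0" by linarith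
    define v' where "v' = - s / ?v z"
    have v: "(?v has_real_derivative v') (at z within {-R..R})"
      using pos unfolding v'_def by (auto intro!: derivative_eq_intros simp: divide_simps)
    have "(?M has_real_derivative - ((v' * L (?v z) + G (?v z) * v' * ?v z - L (?v z) * v') / s)) (at z within {-R..R})"
      by (rule DERIV_minus DERIV_cdivide DERIV_diff DERIV_mult DERIV_chain2[OF L] DERIV_chain2[OF N] v)+
    moreover have "- ((v' * L (?v z) + G (?v z) * v' * ?v z - L (?v z) * v') / s) = G (?v z)"
    proof -
      have "G (?v z) * v' * ?v z = - (G (?v z) * s)" using pos by (simp add: v'_def)
      then show ?thesis using s by simp
    qed
    ultimately show "(?M has_vector_derivative G (?v z)) (at z within {-R..R})"
      by (simp add: has_real_derivative_iff_has_vector_derivative)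
  qed (use s in auto)
  moreover have "?v R = R - s"
    using s real_sqrt_abs[of "R - s"] by (simp add: power2_diff)
  moreover have "?v (-R) = R + s"
    using s real_sqrt_abs[of "R + s"] by (simp add: power2_sum)
  moreover have "- (((R - s) * L (R - s) - N (R - s)) / s) - - (((R + s) * L (R + s) - N (R + s)) / s)
      = ((R + s) * L (R + s) - (R - s) * L (R - s) - N (R + s) + N (R - s)) / s"
    by (simp add: diff_divide_distrib add_divide_distrib)
  ultimately show ?thesis by (simp only:)
qed

section \<open>Radial kernels integrated over a ball\<close>

text \<open>Each slice contributes a difference of two values of \<open>G\<close>, and integrating over the slices costs
  two more primitives: one for the axis, and one more for the rim, where the substitution
  \<open>v = sqrt (R\<^sup>2 + s\<^sup>2 - 2 z s)\<close> brings in an extra factor \<open>v\<close>. For \<open>s = 0\<close> the rim is at constant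
  distance \<open>R\<close>, and that substitution degenerates.\<close>

theorem nn_integral_cball_radial_kernel:
  fixes k G L N :: "real \<Rightarrow> real" and a c :: "real^3"
  defines "s \<equiv> dist a c"
  assumes k: "continuous_on UNIV k" "\<And>t. t \<ge> 0 \<Longrightarrow> k t \<ge> 0"
    and G: "\<And>t. (G has_real_derivative k t) (at t)"
    and L: "\<And>t. (L has_real_derivative G t) (at t)"
    and N: "\<And>t. (N has_real_derivative L t) (at t)"
    and sR: "s < R"
  shows "(\<integral>\<^sup>+ y. ennreal (k (dist y a) / dist y a) * indicator (cball c R) y \<partial>lborel)
       = ennreal (if s = 0 then 4 * pi * (R * G R - L R + L 0)
           else 2 * pi * ((R * (L (R + s) - L (R - s)) - N (R + s) + N (R - s)) / s + 2 * L 0))"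
    (is "?I = ennreal ?V")
proof -
  have s0: "s \<ge> 0" by (simp add: s_def)
  have R0: "R > 0" using s0 sR by linarith
  have [measurable]: "k \<in> borel_measurable borel" using k(1) by (rule borel_measurable_continuous_onI)
  define F where "F z = 2 * pi * (G (sqrt (R\<^sup>2 + s\<^sup>2 - 2 * z * s)) - G \<bar>z - s\<bar>)" for z
  have sq: "(z - s)\<^sup>2 + (R\<^sup>2 - z\<^sup>2) = R\<^sup>2 + s\<^sup>2 - 2 * z * s" for z
    by (simp add: power2_eq_square algebra_simps)
  have slice: "R\<^sup>2 - z\<^sup>2 \<ge> 0" if "z \<in> {-R..R}" for z
    using that abs_le_square_iff[of z R] R0 by (simp add: abs_le_iff)
  have F0: "F z \<ge> 0" if "z \<in> {-R..R}" for z
  proof -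
    have "\<bar>z - s\<bar> \<le> sqrt ((z - s)\<^sup>2 + (R\<^sup>2 - z\<^sup>2))"
      using slice[OF that] by (intro real_le_rsqrt) simp
    then have "G \<bar>z - s\<bar> \<le> G (sqrt ((z - s)\<^sup>2 + (R\<^sup>2 - z\<^sup>2)))"
    proof (rule DERIV_nonneg_imp_nondecreasing)
      fix t assume "\<bar>z - s\<bar> \<le> t"
      then have "t \<ge> 0" by linarith
      with G k(2) show "\<exists>y. (G has_real_derivative y) (at t) \<and> 0 \<le> y" by blast
    qed
    then show ?thesis by (simp add: F_def sq)
  qed
  have "?I = (\<integral>\<^sup>+ y. ennreal (k (norm (y - s *\<^sub>R axis 1 1 :: real^3)) / norm (y - s *\<^sub>R axis 1 1))
                * indicator (cball 0 R) y \<partial>lborel)"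
    unfolding s_def by (rule nn_integral_cball_rotate[of "\<lambda>t. ennreal (k t / t)"]) measurable
  also have "\<dots> = (\<integral>\<^sup>+ z. ennreal pi * (\<integral>\<^sup>+ u. ennreal (k (sqrt ((z - s)\<^sup>2 + u)) / sqrt ((z - s)\<^sup>2 + u))
                * indicator {0..R\<^sup>2 - z\<^sup>2} u \<partial>lborel) * indicator {-R..R} z \<partial>lborel)"
    by (rule nn_integral_cball_slices[of "\<lambda>t. ennreal (k t / t)"]) (measurable, use R0 in simp)
  also have "\<dots> = (\<integral>\<^sup>+ z. ennreal (F z) * indicator {-R..R} z \<partial>lborel)"
  proof (rule nn_integral_cong)
    fix z :: real
    show "ennreal pi * (\<integral>\<^sup>+ u. ennreal (k (sqrt ((z - s)\<^sup>2 + u)) / sqrt ((z - s)\<^sup>2 + u))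
                * indicator {0..R\<^sup>2 - z\<^sup>2} u \<partial>lborel) * indicator {-R..R} z
        = ennreal (F z) * indicator {-R..R} z"
    proof (cases "z \<in> {-R..R}")
      case True
      then have "G (sqrt ((z - s)\<^sup>2 + (R\<^sup>2 - z\<^sup>2))) - G \<bar>z - s\<bar> \<ge> 0"
        using F0[OF True] pi_gt_zero by (simp add: F_def sq zero_le_mult_iff not_le[symmetric])
      moreover have "(\<integral>\<^sup>+ u. ennreal (k (sqrt ((z - s)\<^sup>2 + u)) / sqrt ((z - s)\<^sup>2 + u))
                * indicator {0..R\<^sup>2 - z\<^sup>2} u \<partial>lborel)
            = ennreal (2 * (G (sqrt ((z - s)\<^sup>2 + (R\<^sup>2 - z\<^sup>2))) - G \<bar>z - s\<bar>))"
        by (rule nn_integral_radial_kernel_slice[OF G k(2) slice[OF True]])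
      ultimately show ?thesis
        using True by (simp add: F_def sq mult.assoc mult.left_commute flip: ennreal_mult')
    qed simp
  qed
  also have "\<dots> = ennreal ?V"
  proof (rule nn_integral_has_integral_lebesgue')
    have abs: "((\<lambda>z. G \<bar>z - s\<bar>) has_integral L (R - s) + L (R + s) - 2 * L 0) {-R..R}"
      using L s0 sR by (intro has_integral_primitive_abs) auto
    show "(F has_integral ?V) {-R..R}"
    proof (cases "s = 0")
      case True
      have "((\<lambda>z. G R) has_integral (R - - R) *\<^sub>R G R) {-R..R}"
        using has_integral_const_real[of "G R" "-R" R] R0 by simp
      then have "((\<lambda>z. 2 * pi * (G R - G \<bar>z - s\<bar>)) has_integral
            2 * pi * ((R - - R) *\<^sub>R G R - (L (R - s) + L (R + s) - 2 * L 0))) {-R..R}"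
        using abs by (intro has_integral_mult_right has_integral_diff)
      then show ?thesis using True R0 by (simp add: F_def[abs_def] algebra_simps)
    next
      case False
      then have "s > 0" using s0 by simp
      let ?C = "((R + s) * L (R + s) - (R - s) * L (R - s) - N (R + s) + N (R - s)) / s"
      have "(F has_integral 2 * pi * (?C - (L (R - s) + L (R + s) - 2 * L 0))) {-R..R}"
        unfolding F_def[abs_def]
        by (intro has_integral_mult_right has_integral_diff abs
             has_integral_primitive_chord L N \<open>s > 0\<close> sR)
      moreover have "?C - (L (R - s) + L (R + s) - 2 * L 0)
          = (R * (L (R + s) - L (R - s)) - N (R + s) + N (R - s)) / s + 2 * L 0"
        using False by (simp add: field_simps)
      ultimately show ?thesis using False by simp
    qed
  qed (rule F0)
  finally show ?thesis .
qed

lemma nn_integral_cball_exp_kernel: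
  fixes a c :: "real^3"
  assumes "\<nu> \<noteq> 0" "dist a c < R"
  shows "(\<integral>\<^sup>+ y. ennreal (exp (\<nu> * dist y a) / dist y a) * indicator (cball c R) y \<partial>lborel)
    = ennreal (if a = c then 4 * pi * (R * exp (\<nu> * R) / \<nu> - exp (\<nu> * R) / \<nu>\<^sup>2 + 1 / \<nu>\<^sup>2)
        else 4 * pi / \<nu>\<^sup>2 * (1 + exp (\<nu> * R) * (R - 1 / \<nu>) * sinh (\<nu> * dist a c) / dist a c))"
proof -
  define s where "s = dist a c"
  have "(\<integral>\<^sup>+ y. ennreal (exp (\<nu> * dist y a) / dist y a) * indicator (cball c R) y \<partial>lborel)
     = ennreal (if dist a c = 0 then 4 * pi * (R * (exp (\<nu> * R) / \<nu>) - exp (\<nu> * R) / \<nu>\<^sup>2 + exp (\<nu> * 0) / \<nu>\<^sup>2)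
       else 2 * pi * ((R * (exp (\<nu> * (R + dist a c)) / \<nu>\<^sup>2 - exp (\<nu> * (R - dist a c)) / \<nu>\<^sup>2)
          - exp (\<nu> * (R + dist a c)) / \<nu>^3 + exp (\<nu> * (R - dist a c)) / \<nu>^3) / dist a c + 2 * (exp (\<nu> * 0) / \<nu>\<^sup>2)))"
    by (rule nn_integral_cball_radial_kernel[OF _ _ _ _ _ assms(2)])
      (use assms(1) in \<open>auto intro!: continuous_intros derivative_eq_intros simp: power2_eq_square power3_eq_cube\<close>)
  also have "\<dots> = ennreal (if s = 0 then 4 * pi * (R * exp (\<nu> * R) / \<nu> - exp (\<nu> * R) / \<nu>\<^sup>2 + 1 / \<nu>\<^sup>2)
        else 4 * pi / \<nu>\<^sup>2 * (1 + exp (\<nu> * R) * (R - 1 / \<nu>) * sinh (\<nu> * s) / s))"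
  proof -
    have e: "exp (\<nu> * (R + s)) = exp (\<nu> * R) * exp (\<nu> * s)" "exp (\<nu> * (R - s)) = exp (\<nu> * R) * exp (- (\<nu> * s))"
      by (simp_all add: algebra_simps flip: exp_add)
    have "2 * pi * ((R * (exp (\<nu> * (R + s)) / \<nu>\<^sup>2 - exp (\<nu> * (R - s)) / \<nu>\<^sup>2)
          - exp (\<nu> * (R + s)) / \<nu>^3 + exp (\<nu> * (R - s)) / \<nu>^3) / s + 2 * (exp (\<nu> * 0) / \<nu>\<^sup>2))
        = 4 * pi / \<nu>\<^sup>2 * (1 + exp (\<nu> * R) * (R - 1 / \<nu>) * sinh (\<nu> * s) / s)" if "s \<noteq> 0"
      unfolding e sinh_field_def using that assms(1)
      by (simp add: field_simps power2_eq_square power3_eq_cube)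
    then show ?thesis by (simp add: s_def)
  qed
  finally show ?thesis by (simp add: s_def)
qed

text \<open>The integral of \<open>sinh (\<mu> |y|) / |y|\<close> over the ball of radius \<open>R\<close>.\<close>

definition ball_sinh_integral :: "real \<Rightarrow> real \<Rightarrow> real" where
  "ball_sinh_integral \<mu> R = 4 * pi * (\<mu> * R * cosh (\<mu> * R) - sinh (\<mu> * R)) / \<mu>\<^sup>2"

text \<open>This is the mean value property of \<open>sinh (\<mu> |y - a|) / |y - a|\<close>, which solves
  \<open>\<Delta> u = \<mu>\<^sup>2 u\<close> on the whole space: the integral over a ball is a multiple, depending only on the
  radius, of the value at the centre. That value is written as a case distinction because the kernel
  has the junk value \<open>0\<close> instead of \<open>\<mu>\<close> at its pole.\<close>

lemma nn_integral_cball_sinh_kernel: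
  fixes a c :: "real^3"
  assumes "\<mu> > 0" "dist a c < R"
  shows "(\<integral>\<^sup>+ y. ennreal (sinh (\<mu> * dist y a) / dist y a) * indicator (cball c R) y \<partial>lborel)
    = ennreal (ball_sinh_integral \<mu> R * (if a = c then 1 else sinh (\<mu> * dist a c) / (\<mu> * dist a c)))"
proof -
  define s where "s = dist a c"
  have "(\<integral>\<^sup>+ y. ennreal (sinh (\<mu> * dist y a) / dist y a) * indicator (cball c R) y \<partial>lborel)
     = ennreal (if dist a c = 0 then 4 * pi * (R * (cosh (\<mu> * R) / \<mu>) - sinh (\<mu> * R) / \<mu>\<^sup>2 + sinh (\<mu> * 0) / \<mu>\<^sup>2)
       else 2 * pi * ((R * (sinh (\<mu> * (R + dist a c)) / \<mu>\<^sup>2 - sinh (\<mu> * (R - dist a c)) / \<mu>\<^sup>2)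
          - cosh (\<mu> * (R + dist a c)) / \<mu>^3 + cosh (\<mu> * (R - dist a c)) / \<mu>^3) / dist a c + 2 * (sinh (\<mu> * 0) / \<mu>\<^sup>2)))"
    by (rule nn_integral_cball_radial_kernel[OF _ _ _ _ _ assms(2)])
      (use assms(1) in \<open>auto intro!: continuous_intros derivative_eq_intros simp: power2_eq_square power3_eq_cube\<close>)
  also have "\<dots> = ennreal (ball_sinh_integral \<mu> R * (if s = 0 then 1 else sinh (\<mu> * s) / (\<mu> * s)))"
  proof -
    have "2 * pi * ((R * (sinh (\<mu> * (R + s)) / \<mu>\<^sup>2 - sinh (\<mu> * (R - s)) / \<mu>\<^sup>2)
          - cosh (\<mu> * (R + s)) / \<mu>^3 + cosh (\<mu> * (R - s)) / \<mu>^3) / s + 2 * (sinh (\<mu> * 0) / \<mu>\<^sup>2))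
        = ball_sinh_integral \<mu> R * (sinh (\<mu> * s) / (\<mu> * s))" if "s \<noteq> 0"
      unfolding distrib_left right_diff_distrib sinh_add sinh_diff cosh_add cosh_diff ball_sinh_integral_def
      using that assms(1) by (simp add: field_simps power2_eq_square power3_eq_cube)
    moreover have "4 * pi * (R * (cosh (\<mu> * R) / \<mu>) - sinh (\<mu> * R) / \<mu>\<^sup>2 + sinh (\<mu> * 0) / \<mu>\<^sup>2) = ball_sinh_integral \<mu> R"
      using assms(1) by (simp add: ball_sinh_integral_def field_simps power2_eq_square)
    ultimately show ?thesis by (simp add: s_def)
  qed
  finally show ?thesis by (simp add: s_def)
qed

lemma t_cosh_minus_sinh_strict_mono:
  fixes s t :: real
  assumes "0 \<le> s" "s < t"
  shows "s * cosh s - sinh s < t * cosh t - sinh t"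
proof (rule DERIV_pos_imp_increasing_open[OF assms(2)])
  fix x assume "s < x" "x < t"
  then have "x * sinh x > 0" using assms by simp
  moreover have "((\<lambda>x. x * cosh x - sinh x) has_real_derivative x * sinh x) (at x)"
    by (auto intro!: derivative_eq_intros)
  ultimately show "\<exists>y. ((\<lambda>x. x * cosh x - sinh x) has_real_derivative y) (at x) \<and> 0 < y" by blast
qed (intro continuous_intros)

lemma ball_sinh_integral_strict_mono:
  assumes "\<mu> > 0" "0 \<le> R" "R < R'"
  shows "ball_sinh_integral \<mu> R < ball_sinh_integral \<mu> R'"
  using t_cosh_minus_sinh_strict_mono[of "\<mu> * R" "\<mu> * R'"] assms
  by (simp add: ball_sinh_integral_def divide_strict_right_mono)

text \<open>Strict monotonicity holds from \<open>s = 0\<close> on also with division by zero, since the value \<open>0\<close> at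
  \<open>s = 0\<close> lies below the true limit \<open>\<mu>\<close>.\<close>

lemma sinh_kernel_strict_mono:
  fixes s t :: real
  assumes "\<mu> > 0" "0 \<le> s" "s < t"
  shows "sinh (\<mu> * s) / s < sinh (\<mu> * t) / t"
proof (cases "s = 0")
  case False
  then have "s > 0" using assms by simp
  show ?thesis
  proof (rule DERIV_pos_imp_increasing[OF assms(3)])
    fix x assume "s \<le> x" "x \<le> t"
    then have x: "x > 0" using \<open>s > 0\<close> by simp
    then have "(\<mu> * x) * cosh (\<mu> * x) - sinh (\<mu> * x) > 0"
      using t_cosh_minus_sinh_strict_mono[of 0 "\<mu> * x"] \<open>\<mu> > 0\<close> by simp
    then have "(cosh (\<mu> * x) * \<mu> * x - sinh (\<mu> * x)) / (x * x) > 0"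
      using x by (simp add: mult_ac)
    moreover have "((\<lambda>x. sinh (\<mu> * x) / x) has_real_derivative (cosh (\<mu> * x) * \<mu> * x - sinh (\<mu> * x)) / (x * x)) (at x)"
      using x by (auto intro!: derivative_eq_intros)
    ultimately show "\<exists>y. ((\<lambda>x. sinh (\<mu> * x) / x) has_real_derivative y) (at x) \<and> 0 < y" by blast
  qed
qed (use assms in auto)

text \<open>Up to a common factor, with \<open>\<rho> = \<mu> r\<close> and \<open>\<sigma> = \<mu> s\<close>, the left-hand side is the potential of the
  ball of radius \<open>r\<close> at distance \<open>s\<close> from its centre, and the right-hand side is the formula valid outside
  the ball, continued to the inside. For \<open>\<rho> = \<sigma>\<close> the point lies on the sphere and the two agree. Growing
  the ball by a shell raises the right-hand side by more, because inside a shell the kernel averages to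
  less than the continued outer formula.\<close>

lemma screened_potential_inside_less:
  fixes \<rho> \<sigma> :: real
  assumes "0 < \<sigma>" "\<sigma> < \<rho>"
  shows "\<sigma> - exp (- \<rho>) * (\<rho> + 1) * sinh \<sigma> < (\<rho> * cosh \<rho> - sinh \<rho>) * exp (- \<sigma>)"
proof -
  let ?h = "\<lambda>\<rho>. (\<rho> * cosh \<rho> - sinh \<rho>) * exp (- \<sigma>) + exp (- \<rho>) * (\<rho> + 1) * sinh \<sigma>"
  have "?h \<sigma> < ?h \<rho>"
  proof (rule DERIV_pos_imp_increasing_open[OF assms(2)])
    fix x assume x: "\<sigma> < x" "x < \<rho>"
    then have "x * sinh (x - \<sigma>) > 0" using assms by simp
    \<comment> \<open>The right-hand side minus the left-hand side has derivative \<open>x * sinh (x - \<sigma>)\<close> in the radius.\<close>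
    moreover have "x * sinh (x - \<sigma>) = x * sinh x * exp (- \<sigma>) - x * exp (- x) * sinh \<sigma>"
      unfolding sinh_diff cosh_minus_sinh[symmetric] by (simp add: algebra_simps)
    moreover have "(?h has_real_derivative x * sinh x * exp (- \<sigma>) - x * exp (- x) * sinh \<sigma>) (at x)"
      by (rule derivative_eq_intros refl | simp add: algebra_simps)+
    ultimately show "\<exists>y. (?h has_real_derivative y) (at x) \<and> 0 < y"
      by (intro exI[of _ "x * sinh x * exp (- \<sigma>) - x * exp (- x) * sinh \<sigma>"]) simp
  qed (intro continuous_intros)
  moreover have "?h \<sigma> = \<sigma>"
  proof -
    have "?h \<sigma> = \<sigma> * ((cosh \<sigma> + sinh \<sigma>) * exp (- \<sigma>))" by (simp add: algebra_simps)
    also have "(cosh \<sigma> + sinh \<sigma>) * exp (- \<sigma>) = 1" by (simp add: cosh_plus_sinh flip: exp_add)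
    finally show ?thesis by simp
  qed
  ultimately show ?thesis by simp
qed

section \<open>From the exterior identity to the centre\<close>

lemma borel_measurable_sinh [measurable (raw)]:
  fixes f :: "'a \<Rightarrow> real"
  assumes "f \<in> borel_measurable M"
  shows "(\<lambda>x. sinh (f x)) \<in> borel_measurable M"
  using assms by (rule borel_measurable_continuous_on[rotated]) (intro continuous_intros)

lemma E_kernel_measurable [measurable]:
  "(\<lambda>y. E_plus \<mu> y x) \<in> borel_measurable borel" "(\<lambda>y. E_minus \<mu> y x) \<in> borel_measurable borel"
  unfolding E_plus_def E_minus_def by measurable

text \<open>The pole may lie anywhere, even in \<open>D\<close>: a large ball centred at the pole contains \<open>D\<close>, and there the
  integral has a finite closed form.\<close>

lemma set_integrable_exp_kernel:
  fixes x :: "real^3" and \<nu> :: real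
  assumes "\<nu> \<noteq> 0" "D \<in> sets borel" "bounded D"
  shows "set_integrable lborel D (\<lambda>y. exp (\<nu> * dist y x) / dist y x)"
proof -
  obtain R where R: "R > 0" "D \<subseteq> cball x R"
    using bounded_subset_ballD[OF \<open>bounded D\<close>, of x] ball_subset_cball by blast
  have [measurable]: "cball x R \<in> sets borel" by simp
  have meas: "(\<lambda>y. indicat_real (cball x R) y *\<^sub>R (exp (\<nu> * dist y x) / dist y x)) \<in> borel_measurable borel"
    by measurable
  have "set_integrable lborel (cball x R) (\<lambda>y. exp (\<nu> * dist y x) / dist y x)"
    unfolding set_integrable_def
  proof (rule integrableI_nonneg)
    have "(\<integral>\<^sup>+ y. ennreal (indicat_real (cball x R) y *\<^sub>R (exp (\<nu> * dist y x) / dist y x)) \<partial>lborel)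
        = (\<integral>\<^sup>+ y. ennreal (exp (\<nu> * dist y x) / dist y x) * indicator (cball x R) y \<partial>lborel)"
      by (intro nn_integral_cong) (simp add: indicator_def)
    also have "\<dots> < \<infinity>"
      using R by (subst nn_integral_cball_exp_kernel[OF assms(1)]) auto
    finally show "(\<integral>\<^sup>+ y. ennreal (indicat_real (cball x R) y *\<^sub>R (exp (\<nu> * dist y x) / dist y x)) \<partial>lborel) < \<infinity>" .
  qed (use meas in auto)
  then show ?thesis
    using R assms by (elim set_integrable_subset) auto
qed

lemma E_eq_dist:
  "E_plus \<mu> y x = exp (\<mu> * dist y x) / dist y x" "E_minus \<mu> y x = exp (- \<mu> * dist y x) / dist y x"
  by (simp_all add: E_plus_def E_minus_def dist_norm)

lemma nn_integral_shell_sinh_kernel: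
  fixes a c :: "real^3"
  assumes "\<mu> > 0" "dist a c < R" "R < R'"
  shows "(\<integral>\<^sup>+ x. ennreal (sinh (\<mu> * dist x a) / dist x a) * indicator (cball c R' - cball c R) x \<partial>lborel)
    = ennreal ((ball_sinh_integral \<mu> R' - ball_sinh_integral \<mu> R) * (if a = c then 1 else sinh (\<mu> * dist a c) / (\<mu> * dist a c)))"
    (is "?S = ennreal ((?b' - ?b) * ?m)")
proof -
  have m: "?m \<ge> 0" using \<open>\<mu> > 0\<close> by simp
  have R: "0 \<le> R" using assms(2) zero_le_dist[of a c] by linarith
  have b: "?b \<ge> 0" "?b \<le> ?b'"
    using ball_sinh_integral_strict_mono[of \<mu> 0 R] ball_sinh_integral_strict_mono[of \<mu> R R'] R assms
    by (cases "R = 0"; force simp: ball_sinh_integral_def)+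
  let ?f = "\<lambda>x. ennreal (sinh (\<mu> * dist x a) / dist x a)"
  have [measurable]: "cball c R \<in> sets borel" "cball c R' \<in> sets borel" by simp_all
  have "ennreal (?b' * ?m) = (\<integral>\<^sup>+ x. ?f x * indicator (cball c R') x \<partial>lborel)"
    using assms by (subst nn_integral_cball_sinh_kernel) auto
  also have "\<dots> = (\<integral>\<^sup>+ x. ?f x * indicator (cball c R) x + ?f x * indicator (cball c R' - cball c R) x \<partial>lborel)"
    using \<open>R < R'\<close> by (intro nn_integral_cong) (auto simp: indicator_def)
  also have "\<dots> = (\<integral>\<^sup>+ x. ?f x * indicator (cball c R) x \<partial>lborel) + ?S"
    by (rule nn_integral_add) measurable
  also have "(\<integral>\<^sup>+ x. ?f x * indicator (cball c R) x \<partial>lborel) = ennreal (?b * ?m)"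
    using assms by (subst nn_integral_cball_sinh_kernel) auto
  finally have "ennreal (?b' * ?m) - ennreal (?b * ?m) = ?S" by simp
  moreover have "ennreal (?b' * ?m) - ennreal (?b * ?m) = ennreal ((?b' - ?b) * ?m)"
    using b m by (subst ennreal_minus) (auto simp: left_diff_distrib)
  ultimately show ?thesis by simp
qed

text \<open>The two sides of the exterior identity extend to solutions of \<open>\<Delta> u = \<mu>\<^sup>2 u\<close> on the whole space, so
  the identity ought to persist at \<open>x\<^sub>0\<close> by analytic continuation. Integrating it in \<open>x\<close> over a spherical
  shell about \<open>x\<^sub>0\<close> that avoids \<open>D\<close> gives the same conclusion by elementary means: by the mean
  value property and the symmetry of the kernel, the shell replaces \<open>x\<close> by \<open>x\<^sub>0\<close> on both sides, up to a
  common factor. Since the kernel tends to \<open>\<mu>\<close> at its pole, the value at the centre is \<open>C * \<mu>\<close>.\<close>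

lemma nn_integral_sinh_kernel_center:
  fixes x\<^sub>0 :: "real^3"
  assumes \<mu>: "\<mu> > 0" and D[measurable]: "D \<in> sets borel" and "bounded D" and "C \<ge> 0"
    and outside: "\<And>x. x \<notin> D \<Longrightarrow>
      (\<integral>\<^sup>+ y. ennreal (sinh (\<mu> * dist y x) / dist y x) * indicator D y \<partial>lborel)
        = ennreal (C * (sinh (\<mu> * dist x x\<^sub>0) / dist x x\<^sub>0))"
  shows "(\<integral>\<^sup>+ y. ennreal (sinh (\<mu> * dist y x\<^sub>0) / dist y x\<^sub>0) * indicator D y \<partial>lborel) = ennreal (C * \<mu>)"
proof -
  let ?w = "\<lambda>y x :: real^3. ennreal (sinh (\<mu> * dist y x) / dist y x)"
  obtain R where R: "R > 0" "D \<subseteq> ball x\<^sub>0 R"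
    using \<open>bounded D\<close> by (metis bounded_subset_ballD)
  define A where "A = cball x\<^sub>0 (R + 1) - cball x\<^sub>0 R"
  have [measurable]: "A \<in> sets borel" by (simp add: A_def)
  have AD: "A \<inter> D = {}" using R by (auto simp: A_def)
  define K where "K = ball_sinh_integral \<mu> (R + 1) - ball_sinh_integral \<mu> R"
  have K: "K > 0" using ball_sinh_integral_strict_mono[of \<mu> R "R + 1"] \<mu> R by (simp add: K_def)
  have shell: "(\<integral>\<^sup>+ x. ?w x a * indicator A x \<partial>lborel)
      = ennreal (K * (if a = x\<^sub>0 then 1 else sinh (\<mu> * dist a x\<^sub>0) / (\<mu> * dist a x\<^sub>0)))" if "dist a x\<^sub>0 < R" for a
    unfolding A_def K_def using \<mu> that by (intro nn_integral_shell_sinh_kernel) auto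
  have "(\<integral>\<^sup>+ x. (\<integral>\<^sup>+ y. ?w y x * indicator D y * indicator A x \<partial>lborel) \<partial>lborel)
      = (\<integral>\<^sup>+ x. ennreal C * (?w x x\<^sub>0 * indicator A x) \<partial>lborel)"
  proof (rule nn_integral_cong)
    fix x :: "real^3"
    show "(\<integral>\<^sup>+ y. ?w y x * indicator D y * indicator A x \<partial>lborel) = ennreal C * (?w x x\<^sub>0 * indicator A x)"
    proof (cases "x \<in> A")
      case True
      then have "x \<notin> D" using AD by auto
      from outside[OF this] True \<open>C \<ge> 0\<close> show ?thesis by (simp flip: ennreal_mult')
    qed simp
  qed
  also have "\<dots> = ennreal C * ennreal K"
    using shell[of x\<^sub>0] R by (simp add: nn_integral_cmult)
  finally have 1: "(\<integral>\<^sup>+ x. (\<integral>\<^sup>+ y. ?w y x * indicator D y * indicator A x \<partial>lborel) \<partial>lborel) = ennreal C * ennreal K" .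
  have "(\<integral>\<^sup>+ x. (\<integral>\<^sup>+ y. ?w y x * indicator D y * indicator A x \<partial>lborel) \<partial>lborel)
      = (\<integral>\<^sup>+ y. (\<integral>\<^sup>+ x. ?w y x * indicator D y * indicator A x \<partial>lborel) \<partial>lborel)"
    by (rule lborel_pair.Fubini') measurable
  also have "\<dots> = (\<integral>\<^sup>+ y. ennreal (K / \<mu>) * (?w y x\<^sub>0 * indicator D y) \<partial>lborel)"
  proof (rule nn_integral_cong_AE)
    have "AE y in lborel. y \<noteq> x\<^sub>0" by (rule AE_lborel_singleton)
    then show "AE y in lborel. (\<integral>\<^sup>+ x. ?w y x * indicator D y * indicator A x \<partial>lborel)
        = ennreal (K / \<mu>) * (?w y x\<^sub>0 * indicator D y)"
    proof eventually_elim
      case (elim y)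
      show ?case
      proof (cases "y \<in> D")
        case True
        then have "dist y x\<^sub>0 < R" using R by (auto simp: dist_commute)
        from shell[OF this] elim True \<mu> K show ?thesis
          by (simp add: dist_commute[of y] flip: ennreal_mult')
      qed simp
    qed
  qed
  also have "\<dots> = ennreal (K / \<mu>) * (\<integral>\<^sup>+ y. ?w y x\<^sub>0 * indicator D y \<partial>lborel)"
    by (rule nn_integral_cmult) measurable
  finally have "ennreal (K / \<mu>) * (\<integral>\<^sup>+ y. ?w y x\<^sub>0 * indicator D y \<partial>lborel) = ennreal C * ennreal K"
    using 1 by simp
  also have "\<dots> = ennreal (K / \<mu>) * ennreal (C * \<mu>)"
    using K \<mu> \<open>C \<ge> 0\<close> by (simp add: mult.commute flip: ennreal_mult')
  finally show ?thesis
    using K \<mu> by (subst (asm) ennreal_mult_cancel_left) auto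
qed

section \<open>Equality of the domain and the ball up to null sets\<close>

text \<open>Bathtub principle: among sets of given volume, the ball has the smallest integral of a strictly
  increasing radial function, and it is the only minimiser up to null sets. Indeed, by equality of volumes
  \<open>f r\<close> may be subtracted from the integrand, after which passing from the ball to \<open>D\<close> removes negative values
  and adds positive ones.\<close>

lemma AE_eq_cball_of_radial_integral_eq:
  fixes c :: "'a::euclidean_space" and f :: "real \<Rightarrow> real"
  assumes f[measurable]: "f \<in> borel_measurable borel"
    and mono: "\<And>s t. 0 \<le> s \<Longrightarrow> s < t \<Longrightarrow> f s < f t" and f0: "\<And>t. f t \<ge> 0"
    and D[measurable]: "D \<in> sets borel" and "r > 0"
    and vol: "emeasure lborel D = emeasure lborel (cball c r)"
    and int: "(\<integral>\<^sup>+ y. ennreal (f (dist y c)) * indicator D y \<partial>lborel) = ennreal I"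
      "(\<integral>\<^sup>+ y. ennreal (f (dist y c)) * indicator (cball c r) y \<partial>lborel) = ennreal I"
  shows "AE y in lborel. y \<in> D \<longleftrightarrow> y \<in> cball c r"
proof -
  let ?f = "\<lambda>S y. f (dist y c) * indicat_real S y"
  define I' where "I' = max I 0"
  have I': "ennreal I = ennreal I'" "I' \<ge> 0" by (auto simp: I'_def max_def ennreal_neg)
  have [measurable]: "cball c r \<in> sets borel" by simp
  have hb: "has_bochner_integral lborel (?f S) I'"
    if "(\<integral>\<^sup>+ y. ennreal (f (dist y c)) * indicator S y \<partial>lborel) = ennreal I" and [measurable]: "S \<in> sets borel" for S
  proof (rule has_bochner_integral_nn_integral)
    have "(\<integral>\<^sup>+ y. ennreal (?f S y) \<partial>lborel) = (\<integral>\<^sup>+ y. ennreal (f (dist y c)) * indicator S y \<partial>lborel)"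
      by (intro nn_integral_cong) (simp add: indicator_def)
    then show "(\<integral>\<^sup>+ y. ennreal (?f S y) \<partial>lborel) = ennreal I'" using that I' by simp
  qed (use f0 I' in auto)
  have fin: "emeasure lborel (cball c r) < \<infinity>" "emeasure lborel D < \<infinity>"
    using vol emeasure_lborel_cball_finite[of c r] by simp_all
  have hv: "has_bochner_integral lborel (\<lambda>y. f r * indicat_real S y) (f r * measure lborel S)"
    if "S \<in> sets borel" "emeasure lborel S < \<infinity>" for S :: "'a set"
    using that by (intro has_bochner_integral_mult_right has_bochner_integral_real_indicator) auto
  let ?q = "\<lambda>y. (?f D y - f r * indicat_real D y) - (?f (cball c r) y - f r * indicat_real (cball c r) y)"
  have "has_bochner_integral lborel ?q ((I' - f r * measure lborel D) - (I' - f r * measure lborel (cball c r)))"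
    using fin by (intro has_bochner_integral_diff hb hv int) auto
  then have q: "has_bochner_integral lborel ?q 0"
    using vol by (simp add: measure_def)
  have q_eq: "?q y = (f (dist y c) - f r) * (indicat_real D y - indicat_real (cball c r) y)" for y
    by (simp add: algebra_simps)
  have "?q y \<ge> 0" for y
    unfolding q_eq using mono[of "dist y c" r] mono[of r "dist y c"] \<open>r > 0\<close>
    by (cases "dist y c" r rule: linorder_cases) (auto simp: indicator_def dist_commute)
  then have "AE y in lborel. ?q y = 0"
    using q integral_nonneg_eq_0_iff_AE[of lborel ?q] by (auto simp: has_bochner_integral_iff)
  moreover have "AE y in lborel. y \<notin> sphere c r"
    using negligible_sphere[of c r] by (intro AE_not_in) (simp add: negligible_iff_null_sets null_sets_completion_iff)
  ultimately show ?thesis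
  proof eventually_elim
    case (elim y)
    then have "f (dist y c) \<noteq> f r"
      using mono[of "dist y c" r] mono[of r "dist y c"] \<open>r > 0\<close>
      by (cases "dist y c" r rule: linorder_cases) (auto simp: dist_commute)
    with elim(1) have "indicat_real D y = indicat_real (cball c r) y"
      unfolding q_eq by simp
    then show ?case by (auto simp: indicator_def split: if_splits)
  qed
qed

text \<open>Openness upgrades one of the two inclusions to all points. The other one can fail: removing a closed null set
  from the ball keeps it open.\<close>

lemma open_subset_ball_of_AE_cball:
  fixes c :: "'a::euclidean_space"
  assumes "open D" "r > 0" and AE: "AE y in lborel. y \<in> D \<longleftrightarrow> y \<in> cball c r"
  shows "D \<subseteq> ball c r"
proof -
  have "AE y in lborel. y \<notin> D - cball c r" using AE by eventually_elim auto
  moreover have "open (D - cball c r)" using \<open>open D\<close> by (simp add: open_Diff)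
  ultimately have "D - cball c r \<in> null_sets lborel"
    by (subst AE_iff_null_sets) auto
  then have "negligible (D - cball c r)"
    unfolding negligible_iff_null_sets by (rule null_sets_completionI)
  then have "D - cball c r = {}"
    using \<open>open (D - cball c r)\<close> open_not_negligible by blast
  then have "D \<subseteq> interior (cball c r)"
    using \<open>open D\<close> by (intro interior_maximal) auto
  then show ?thesis by (simp add: interior_cball)
qed

section \<open>The two exponential kernels\<close>

lemma set_lebesgue_integral_lebesgue_eq_lborel:
  fixes f :: "'a::euclidean_space \<Rightarrow> real"
  assumes "f \<in> borel_measurable borel" "D \<in> sets borel"
  shows "(LINT y:D|lebesgue. f y) = (LINT y:D|lborel. f y)"
proof -
  note [measurable] = assms
  have "(\<lambda>y. indicat_real D y *\<^sub>R f y) \<in> borel_measurable borel" by measurable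
  then show ?thesis
    unfolding set_lebesgue_integral_def by (intro integral_completion) simp
qed

lemma nn_integral_E_minus:
  fixes x :: "real^3"
  assumes "\<mu> > 0" "D \<in> sets borel" "bounded D"
  shows "(\<integral>\<^sup>+ y. ennreal (E_minus \<mu> y x) * indicator D y \<partial>lborel) = ennreal (LINT y:D|lebesgue. E_minus \<mu> y x)"
proof -
  have int: "set_integrable lborel D (\<lambda>y. E_minus \<mu> y x)"
    unfolding E_eq_dist using assms by (intro set_integrable_exp_kernel) auto
  have "(\<integral>\<^sup>+ y. ennreal (E_minus \<mu> y x) * indicator D y \<partial>lborel)
      = (\<integral>\<^sup>+ y. ennreal (indicat_real D y *\<^sub>R E_minus \<mu> y x) \<partial>lborel)"
    by (intro nn_integral_cong) (simp add: indicator_def)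
  also have "\<dots> = ennreal (LINT y:D|lborel. E_minus \<mu> y x)"
    using int unfolding set_lebesgue_integral_def set_integrable_def
    by (rule nn_integral_eq_integral) (simp add: E_minus_def)
  also have "(LINT y:D|lborel. E_minus \<mu> y x) = (LINT y:D|lebesgue. E_minus \<mu> y x)"
    by (rule set_lebesgue_integral_lebesgue_eq_lborel[OF E_kernel_measurable(2) assms(2), symmetric])
  finally show ?thesis .
qed

text \<open>Half the difference of the two exponential kernels is the \<open>sinh\<close> kernel, whose singularity has cancelled.\<close>

lemma nn_integral_sinh_kernel_eq_E:
  fixes x :: "real^3"
  assumes "\<mu> > 0" "D \<in> sets borel" "bounded D"
  shows "(\<integral>\<^sup>+ y. ennreal (sinh (\<mu> * dist y x) / dist y x) * indicator D y \<partial>lborel)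
    = ennreal (((LINT y:D|lebesgue. E_plus \<mu> y x) - (LINT y:D|lebesgue. E_minus \<mu> y x)) / 2)"
proof -
  have sinh: "sinh (\<mu> * dist y x) / dist y x = (E_plus \<mu> y x - E_minus \<mu> y x) / 2" for y
    by (simp add: E_eq_dist sinh_field_def diff_divide_distrib)
  have int: "set_integrable lborel D (\<lambda>y. E_plus \<mu> y x)" "set_integrable lborel D (\<lambda>y. E_minus \<mu> y x)"
    unfolding E_eq_dist using assms by (intro set_integrable_exp_kernel; auto)+
  then have int': "set_integrable lborel D (\<lambda>y. (E_plus \<mu> y x - E_minus \<mu> y x) / 2)"
    by (intro set_integrable_divide set_integral_diff)
  have "(\<integral>\<^sup>+ y. ennreal (sinh (\<mu> * dist y x) / dist y x) * indicator D y \<partial>lborel)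
      = (\<integral>\<^sup>+ y. ennreal (indicat_real D y *\<^sub>R ((E_plus \<mu> y x - E_minus \<mu> y x) / 2)) \<partial>lborel)"
    unfolding sinh by (intro nn_integral_cong) (simp add: indicator_def)
  also have "\<dots> = ennreal (LINT y:D|lborel. (E_plus \<mu> y x - E_minus \<mu> y x) / 2)"
    using int' unfolding set_lebesgue_integral_def set_integrable_def
  proof (rule nn_integral_eq_integral)
    show "AE y in lborel. 0 \<le> indicat_real D y *\<^sub>R ((E_plus \<mu> y x - E_minus \<mu> y x) / 2)"
      unfolding sinh[symmetric] using \<open>\<mu> > 0\<close> by (intro AE_I2 scaleR_nonneg_nonneg) auto
  qed
  also have "(LINT y:D|lborel. (E_plus \<mu> y x - E_minus \<mu> y x) / 2)
      = ((LINT y:D|lborel. E_plus \<mu> y x) - (LINT y:D|lborel. E_minus \<mu> y x)) / 2"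
    by (simp add: set_integral_diff(2)[OF int])
  also have "(LINT y:D|lborel. E_plus \<mu> y x) = (LINT y:D|lebesgue. E_plus \<mu> y x)"
    by (rule set_lebesgue_integral_lebesgue_eq_lborel[OF E_kernel_measurable(1) assms(2), symmetric])
  also have "(LINT y:D|lborel. E_minus \<mu> y x) = (LINT y:D|lebesgue. E_minus \<mu> y x)"
    by (rule set_lebesgue_integral_lebesgue_eq_lborel[OF E_kernel_measurable(2) assms(2), symmetric])
  finally show ?thesis .
qed

lemma a3_times_ball_volume:
  assumes "\<mu> > 0" "r > 0"
  shows "a3 (\<mu> * r) * measure lebesgue (ball (0 :: real^3) r) = ball_sinh_integral \<mu> r / \<mu>"
proof -
  have "measure lebesgue (ball (0 :: real^3) r) = 4 / 3 * r ^ 3 * pi"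
    using sphere_volume[of r 0] assms by simp
  moreover have "3 * (\<mu> * r * cosh (\<mu> * r) - sinh (\<mu> * r)) / (\<mu> * r) ^ 3 * (4 / 3 * r ^ 3 * pi)
      = ball_sinh_integral \<mu> r / \<mu>"
    using assms by (simp add: ball_sinh_integral_def field_simps power2_eq_square power3_eq_cube)
  ultimately show ?thesis
    using assms by (simp only: a3_closed_form mult_pos_pos)
qed

text \<open>Away from its centre, the ball violates the identity with the decaying kernel at every interior
  point. This excludes the null sets that the \<open>sinh\<close> identity cannot see.\<close>

lemma nn_integral_cball_E_minus_less:
  fixes x c :: "real^3"
  assumes \<mu>: "\<mu> > 0" and x: "x \<noteq> c" "dist x c < r"
  shows "(\<integral>\<^sup>+ y. ennreal (E_minus \<mu> y x) * indicator (cball c r) y \<partial>lborel)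
       < ennreal (ball_sinh_integral \<mu> r / \<mu> * E_minus \<mu> x c)"
proof -
  define s where "s = dist x c"
  have s: "0 < s" "s < r" using x by (auto simp: s_def)
  let ?V = "4 * pi / \<mu>\<^sup>2 * (1 - exp (- \<mu> * r) * (r + 1 / \<mu>) * sinh (\<mu> * s) / s)"
  have "(\<integral>\<^sup>+ y. ennreal (E_minus \<mu> y x) * indicator (cball c r) y \<partial>lborel) = ennreal ?V"
    using nn_integral_cball_exp_kernel[of "-\<mu>" x c r] \<mu> x
    by (simp add: E_eq_dist s_def)
  also have "\<dots> < ennreal (ball_sinh_integral \<mu> r / \<mu> * E_minus \<mu> x c)"
  proof (rule ennreal_lessI)
    have "?V = 4 * pi / (\<mu> ^ 3 * s) * (\<mu> * s - exp (- (\<mu> * r)) * (\<mu> * r + 1) * sinh (\<mu> * s))"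
      using \<mu> s by (simp add: field_simps power2_eq_square power3_eq_cube)
    also have "\<dots> < 4 * pi / (\<mu> ^ 3 * s) * ((\<mu> * r * cosh (\<mu> * r) - sinh (\<mu> * r)) * exp (- (\<mu> * s)))"
      using screened_potential_inside_less[of "\<mu> * s" "\<mu> * r"] \<mu> s
      by (intro mult_strict_left_mono) auto
    also have "\<dots> = ball_sinh_integral \<mu> r / \<mu> * E_minus \<mu> x c"
      using \<mu> s by (simp add: ball_sinh_integral_def E_eq_dist s_def power2_eq_square power3_eq_cube)
    finally show "?V < ball_sinh_integral \<mu> r / \<mu> * E_minus \<mu> x c" .
    have "ball_sinh_integral \<mu> r > 0"
      using ball_sinh_integral_strict_mono[of \<mu> 0 r] \<mu> s by (simp add: ball_sinh_integral_def)
    then show "0 < ball_sinh_integral \<mu> r / \<mu> * E_minus \<mu> x c"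
      using \<mu> s by (simp add: E_eq_dist s_def)
  qed
  finally show ?thesis .
qed

section \<open>The ball is the only domain satisfying both identities\<close>

theorem theorem4p5:
  fixes \<mu> r :: real and D :: "(real^3) set" and x\<^sub>0 :: "real^3"
  assumes "\<mu> > 0"
    and "open D" and "connected D" and "bounded D"
    and "connected (- D)"
    and "r > 0" and "measure lebesgue (ball (0 :: real^3) r) = measure lebesgue D"
    and "x\<^sub>0 \<in> D"
    and "\<And>x. x \<notin> D \<Longrightarrow>
           a3 (\<mu> * r) * E_plus \<mu> x x\<^sub>0
             = 1 / measure lebesgue D * (LINT y:D|lebesgue. E_plus \<mu> y x)"
    and "\<And>x. x \<notin> D \<Longrightarrow>
           a3 (\<mu> * r) * E_minus \<mu> x x\<^sub>0
             = 1 / measure lebesgue D * (LINT y:D|lebesgue. E_minus \<mu> y x)"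
  shows "D = ball x\<^sub>0 r"
proof -
  note \<mu> = \<open>\<mu> > 0\<close> and r = \<open>r > 0\<close> and vol = assms(7)
  define C where "C = ball_sinh_integral \<mu> r / \<mu>"
  have C: "a3 (\<mu> * r) * measure lebesgue D = C"
    using a3_times_ball_volume[OF \<mu> r] by (simp add: C_def vol)
  have b: "ball_sinh_integral \<mu> r > 0"
    using ball_sinh_integral_strict_mono[of \<mu> 0 r] \<mu> r by (simp add: ball_sinh_integral_def)
  have C0: "C \<ge> 0" using b \<mu> by (simp add: C_def)
  have D: "D \<in> sets borel" using \<open>open D\<close> by simp
  have vol0: "measure lebesgue D \<noteq> 0"
    using content_ball_pos[OF r, of "0 :: real^3"] by (simp flip: vol)
  have plus: "(LINT y:D|lebesgue. E_plus \<mu> y x) = C * E_plus \<mu> x x\<^sub>0" if "x \<notin> D" for x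
    using assms(9)[OF that] vol0 by (simp add: C[symmetric] field_simps)
  have minus: "(LINT y:D|lebesgue. E_minus \<mu> y x) = C * E_minus \<mu> x x\<^sub>0" if "x \<notin> D" for x
    using assms(10)[OF that] vol0 by (simp add: C[symmetric] field_simps)

  \<comment> \<open>Half the difference of the two identities, moved from the exterior of \<open>D\<close> to \<open>x\<^sub>0\<close>.\<close>
  have "(\<integral>\<^sup>+ y. ennreal (sinh (\<mu> * dist y x\<^sub>0) / dist y x\<^sub>0) * indicator D y \<partial>lborel) = ennreal (C * \<mu>)"
  proof (rule nn_integral_sinh_kernel_center[OF \<mu> D \<open>bounded D\<close> C0])
    fix x assume "x \<notin> D"
    then have "(\<integral>\<^sup>+ y. ennreal (sinh (\<mu> * dist y x) / dist y x) * indicator D y \<partial>lborel)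
        = ennreal ((C * E_plus \<mu> x x\<^sub>0 - C * E_minus \<mu> x x\<^sub>0) / 2)"
      by (simp only: nn_integral_sinh_kernel_eq_E[OF \<mu> D \<open>bounded D\<close>] plus[OF \<open>x \<notin> D\<close>] minus[OF \<open>x \<notin> D\<close>])
    also have "(C * E_plus \<mu> x x\<^sub>0 - C * E_minus \<mu> x x\<^sub>0) / 2 = C * (sinh (\<mu> * dist x x\<^sub>0) / dist x x\<^sub>0)"
      by (simp add: E_eq_dist sinh_field_def right_diff_distrib diff_divide_distrib)
    finally show "(\<integral>\<^sup>+ y. ennreal (sinh (\<mu> * dist y x) / dist y x) * indicator D y \<partial>lborel)
        = ennreal (C * (sinh (\<mu> * dist x x\<^sub>0) / dist x x\<^sub>0))" .
  qed
  then have intD: "(\<integral>\<^sup>+ y. ennreal (sinh (\<mu> * dist y x\<^sub>0) / dist y x\<^sub>0) * indicator D y \<partial>lborel) = ennreal (ball_sinh_integral \<mu> r)"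
    using \<mu> by (simp add: C_def)
  have intB: "(\<integral>\<^sup>+ y. ennreal (sinh (\<mu> * dist y x\<^sub>0) / dist y x\<^sub>0) * indicator (cball x\<^sub>0 r) y \<partial>lborel) = ennreal (ball_sinh_integral \<mu> r)"
    using \<mu> r by (subst nn_integral_cball_sinh_kernel) auto
  have volB: "emeasure lborel D = emeasure lborel (cball x\<^sub>0 r)"
  proof -
    have "emeasure lborel D = ennreal (measure lborel D)"
      using emeasure_bounded_finite[OF \<open>bounded D\<close>] by (simp add: emeasure_eq_ennreal_measure)
    also have "measure lborel D = measure lborel (ball (0 :: real^3) r)" using vol D by simp
    also have "ennreal \<dots> = emeasure lborel (cball x\<^sub>0 r)"
      using r by (simp add: content_ball emeasure_cball)
    finally show ?thesis .
  qed
  have AE: "AE y in lborel. y \<in> D \<longleftrightarrow> y \<in> cball x\<^sub>0 r"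
  proof (rule AE_eq_cball_of_radial_integral_eq[OF _ _ _ D r volB intD intB])
    show "0 \<le> sinh (\<mu> * t) / t" for t
      using \<mu> by (cases "t \<ge> 0") (auto simp: zero_le_divide_iff mult_le_0_iff)
  qed (measurable, rule sinh_kernel_strict_mono[OF \<mu>])
  have sub: "D \<subseteq> ball x\<^sub>0 r"
    using \<open>open D\<close> r AE by (rule open_subset_ball_of_AE_cball)
  show ?thesis
  proof (rule ccontr)
    \<comment> \<open>At a missing point the identity for \<open>E_minus\<close> would hold for the full ball.\<close>
    assume "D \<noteq> ball x\<^sub>0 r"
    with sub obtain x where x: "x \<in> ball x\<^sub>0 r" "x \<notin> D" by blast
    then have x0: "x \<noteq> x\<^sub>0" "dist x x\<^sub>0 < r"
      using \<open>x\<^sub>0 \<in> D\<close> by (auto simp: dist_commute)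
    have "ennreal (C * E_minus \<mu> x x\<^sub>0) = (\<integral>\<^sup>+ y. ennreal (E_minus \<mu> y x) * indicator D y \<partial>lborel)"
      by (simp only: nn_integral_E_minus[OF \<mu> D \<open>bounded D\<close>] minus[OF x(2)])
    also have "\<dots> = (\<integral>\<^sup>+ y. ennreal (E_minus \<mu> y x) * indicator (cball x\<^sub>0 r) y \<partial>lborel)"
      using AE by (intro nn_integral_cong_AE) (auto simp: indicator_def)
    also have "\<dots> < ennreal (C * E_minus \<mu> x x\<^sub>0)"
      unfolding C_def by (rule nn_integral_cball_E_minus_less[OF \<mu> x0])
    finally show False by simp
  qed
qed

end
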